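(* Let an integer $k\ge2$ and $\gamma\in[0,1]$ be given. Let $\beta_{ij}=\beta_{ji}$ ($1\le i\neq j\le k$) be given real numbers and set $\beta_{ii}=-1$ ($1\le i\le k$), such that the $k\times k$ matrix $B=(-\beta_{ij})_{1\le i,j\le k}$ is positive semidefinite. Consider any one of the four ADI schemes (Do, CS, MCS, HV) described in the context, with parameter $\theta>0$. Suppose that the scheme is unconditionally stable (in the sense defined in the context) whenever it is applied to a split semidiscrete system $U'(t)=AU(t)+g(t)$, $A=A_0+A_1+\cdots+A_k$, that is obtained by the central second-order finite difference discretization with parameters $\beta_{ij}$ and the splitting described in the context, of any equation $$\frac{\partial u}{\partial t}=\sum_{i\ne j}d_{ij}u_{x_ix_j}+\sum_{j=1}^k d_{jj}u_{x_jx_j}$$ on $(0,1)^k$, $t>0$, with periodic boundary condition, where $D=(d_{ij})$ is a real symmetric positive semidefinite $k\times k$ matrix satisfying $|d_{ij}|\le\gamma\sqrt{d_{ii}d_{jj}}$ whenever $1\le i,j\le k$, $i\ne j$. Then $\theta$ must satisfy the following bound: - Do scheme: $\theta\ge\max\left\{\frac12,\ \frac12 d_k[(k-1)\gamma+1]\right\}$ with $d_k=\left(1-\frac1k\right)^{k-1}$; - CS scheme: $\theta\ge\max\left\{\frac12,\ \frac12 c_k k\gamma\right\}$ with $c_k=\left(1-\frac1k\right)^{k}$; - MCS scheme: $\theta\ge\max\left\{\frac14,\ \frac12 b_k[(k-1)\gamma+1]\right\}$ with $b_k=\dfrac{1}{1+\left(1+\frac1{k-1}\right)^{k-1}}$;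 - HV scheme: $\theta\ge\max\left\{\frac14,\ \frac12 a_k[(k-1)\gamma+1]\right\}$ with $a_k$ the unique solution $a\in\left(0,\frac12\right)$ of $2a\left(1+\frac{1-a}{k-1}\right)^{k-1}-1=0$.
   Context: Sums $\sum_{i\neq j}$ run over all ordered pairs $(i,j)$ with $1\le i,j\le k$, $i\ne j$. Discretization. On a rectangular grid with constant mesh widths $\Delta x_i>0$, with multi-index $\ell=(\ell_1,\dots,\ell_k)$, unit multi-indices $e_1,\dots,e_k$, and $u_\ell=u(\ell_1\Delta x_1,\dots,\ell_k\Delta x_k,t)$, the spatial derivatives are replaced by $$(u_{x_ix_i})_\ell\approx\frac{u_{\ell+e_i}-2u_\ell+u_{\ell-e_i}}{(\Delta x_i)^2},$$ and, for $i\neq j$, $$(u_{x_ix_j})_\ell\approx\frac{(1+\beta_{ij})(u_{\ell+e_i+e_j}+u_{\ell-e_i-e_j})-(1-\beta_{ij})(u_{\ell-e_i+e_j}+u_{\ell+e_i-e_j})+\beta_{ij}\bigl(4u_\ell-2(u_{\ell+e_i}+u_{\ell+e_j}+u_{\ell-e_i}+u_{\ell-e_j})\bigr)}{4\Delta x_i\Delta x_j}.$$ In the splitting $A=A_0+A_1+\cdots+A_k$, $A_0$ represents all mixed derivative terms and $A_j$ the term $d_{jj}u_{x_jx_j}$ ($1\le j\le k$). Split $g=g_0+\cdots+g_k$ analogously and put $F(t,\xi)=A\xi+g(t)$, $F_j(t,\xi)=A_j\xi+g_j(t)$. ADI schemes. With time step $\Delta t>0$, $t_n=n\Delta t$ and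 parameter $\theta>0$, all four schemes compute $U_n$ from $U_{n-1}$ starting with $Y_0=U_{n-1}+\Delta t\,F(t_{n-1},U_{n-1})$ and $Y_j=Y_{j-1}+\theta\Delta t\,(F_j(t_n,Y_j)-F_j(t_{n-1},U_{n-1}))$ for $j=1,\dots,k$. Then: - Do (Douglas): $U_n=Y_k$. - CS (Craig--Sneyd): $\widetilde Y_0=Y_0+\frac12\Delta t\,(F_0(t_n,Y_k)-F_0(t_{n-1},U_{n-1}))$; $\widetilde Y_j=\widetilde Y_{j-1}+\theta\Delta t\,(F_j(t_n,\widetilde Y_j)-F_j(t_{n-1},U_{n-1}))$, $1\le j\le k$; $U_n=\widetilde Y_k$. - MCS (Modified Craig--Sneyd): $\widehat Y_0=Y_0+\theta\Delta t\,(F_0(t_n,Y_k)-F_0(t_{n-1},U_{n-1}))$; $\widetilde Y_0=\widehat Y_0+(\frac12-\theta)\Delta t\,(F(t_n,Y_k)-F(t_{n-1},U_{n-1}))$; $\widetilde Y_j=\widetilde Y_{j-1}+\theta\Delta t\,(F_j(t_n,\widetilde Y_j)-F_j(t_{n-1},U_{n-1}))$, $1\le j\le k$; $U_n=\widetilde Y_k$. - HV (Hundsdorfer--Verwer): $\widetilde Y_0=Y_0+\frac12\Delta t\,(F(t_n,Y_k)-F(t_{n-1},U_{n-1}))$; $\widetilde Y_j=\widetilde Y_{j-1}+\theta\Delta t\,(F_j(t_n,\widetilde Y_j)-F_j(t_n,Y_k))$, $1\le j\le k$; $U_n=\widetilde Y_k$. Stability functions. Applied to the scalar test equation $U'=(\lambda_0+\cdots+\lambda_k)U$,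 with $z_j=\Delta t\,\lambda_j$, each scheme gives $U_n=M(z_0,\dots,z_k)U_{n-1}$. With $z=z_1+\cdots+z_k$ and $p=\prod_{j=1}^k(1-\theta z_j)$: - Do: $M=1+\frac{z_0+z}{p}$. - CS: $M=1+\frac{z_0+z}{p}+\frac12\frac{z_0(z_0+z)}{p^2}$. - MCS: $M=1+\frac{z_0+z}{p}+\theta\frac{z_0(z_0+z)}{p^2}+\left(\frac12-\theta\right)\frac{(z_0+z)^2}{p^2}$. - HV: $M=1+2\frac{z_0+z}{p}-\frac{z_0+z}{p^2}+\frac12\frac{(z_0+z)^2}{p^2}$. Unconditional stability. Stability is in the von Neumann ($l_2$) sense. With periodic boundary condition the matrices $A_0,\dots,A_k$ are normal and commuting, and their eigenvalues scaled by $\Delta t$ are $$z_0=\sum_{i\ne j}r_{ij}d_{ij}\bigl[-\sin\phi_i\sin\phi_j+\beta_{ij}(1-\cos\phi_i)(1-\cos\phi_j)\bigr],\qquad z_j=-2r_{jj}d_{jj}(1-\cos\phi_j)\ (1\le j\le k),$$ where $r_{ij}=\Delta t/(\Delta x_i\Delta x_j)$ and each $\phi_j$ is an integer multiple of $2\pi/m_j$, $m_j\ge1$ being the number of grid points in the $x_j$-direction. The scheme is called unconditionally stable if $|M(z_0,z_1,\dots,z_k)|\le1$ for all such $(z_0,\dots,z_k)$, for all $\Delta t>0$, all $\Delta x_i>0$ ($1\le i\le k$), all grid dimensions $m_j$ and all corresponding angles $\phi_j$. *)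

theory Defs
  imports "HOL-Analysis.Analysis"
begin

text \<open>
  The dimension \<^term>\<open>k :: nat\<close> indexes the stages of the schemes, so \<open>k \<times> k\<close> matrices and
  vectors of length \<open>k\<close> are functions on \<^typ>\<open>nat\<close> of which only the indices in
  \<^term>\<open>{1..k}\<close> matter.
\<close>

definition pos_semidef :: "nat \<Rightarrow> (nat \<Rightarrow> nat \<Rightarrow> real) \<Rightarrow> bool" where
  "pos_semidef k A \<longleftrightarrow>
     (\<forall>i\<in>{1..k}. \<forall>j\<in>{1..k}. A i j = A j i) \<and>
     (\<forall>x :: nat \<Rightarrow> real. 0 \<le> (\<Sum>i=1..k. \<Sum>j=1..k. x i * A i j * x j))"


subsection \<open>The schemes and their stability functions\<close>

datatype adi_scheme =
    Douglas
  | Craig_Sneyd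
  | Modified_Craig_Sneyd
  | Hundsdorfer_Verwer

text \<open>
  One run through the implicit stages \<open>j = 1, \<dots>, k\<close>, where \<^term>\<open>R j\<close> is the vector
  subtracted from \<^term>\<open>F j t (Y j)\<close>.
\<close>

definition stages ::
  "nat \<Rightarrow> real \<Rightarrow> real \<Rightarrow> (nat \<Rightarrow> real \<Rightarrow> 'a \<Rightarrow> 'a) \<Rightarrow> real \<Rightarrow> (nat \<Rightarrow> 'a) \<Rightarrow>
    (nat \<Rightarrow> 'a :: real_vector) \<Rightarrow> bool" where
  "stages k \<theta> dt F t R Y \<longleftrightarrow>
     (\<forall>j\<in>{1..k}. Y j = Y (j - 1) + (\<theta> * dt) *\<^sub>R (F j t (Y j) - R j))"

definition total :: "nat \<Rightarrow> (nat \<Rightarrow> real \<Rightarrow> 'a \<Rightarrow> 'a) \<Rightarrow> real \<Rightarrow> 'a \<Rightarrow> 'a :: real_vector" where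
  "total k F t x = (\<Sum>j=0..k. F j t x)"

text \<open>
  \<open>adi_step S k \<theta> dt F s U V\<close>: a step of length \<^term>\<open>dt\<close> of the scheme, started from
  \<^term>\<open>U\<close> at time \<^term>\<open>s\<close>, can produce \<^term>\<open>V\<close>.  It is a relation
  because the stages are implicit.
\<close>

fun adi_step ::
  "adi_scheme \<Rightarrow> nat \<Rightarrow> real \<Rightarrow> real \<Rightarrow> (nat \<Rightarrow> real \<Rightarrow> 'a \<Rightarrow> 'a) \<Rightarrow> real \<Rightarrow>
    'a \<Rightarrow> 'a :: real_vector \<Rightarrow> bool" where
  "adi_step Douglas k \<theta> dt F s U V \<longleftrightarrow>
     (\<exists>Y. Y 0 = U + dt *\<^sub>R total k F s U \<and>
          stages k \<theta> dt F (s + dt) (\<lambda>j. F j s U) Y \<and>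
          V = Y k)"
| "adi_step Craig_Sneyd k \<theta> dt F s U V \<longleftrightarrow>
     (\<exists>Y Z. Y 0 = U + dt *\<^sub>R total k F s U \<and>
          stages k \<theta> dt F (s + dt) (\<lambda>j. F j s U) Y \<and>
          Z 0 = Y 0 + (1 / 2 * dt) *\<^sub>R (F 0 (s + dt) (Y k) - F 0 s U) \<and>
          stages k \<theta> dt F (s + dt) (\<lambda>j. F j s U) Z \<and>
          V = Z k)"
| "adi_step Modified_Craig_Sneyd k \<theta> dt F s U V \<longleftrightarrow>
     (\<exists>Y X Z. Y 0 = U + dt *\<^sub>R total k F s U \<and>
          stages k \<theta> dt F (s + dt) (\<lambda>j. F j s U) Y \<and>
          X = Y 0 + (\<theta> * dt) *\<^sub>R (F 0 (s + dt) (Y k) - F 0 s U) \<and>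
          Z 0 = X + ((1 / 2 - \<theta>) * dt) *\<^sub>R (total k F (s + dt) (Y k) - total k F s U) \<and>
          stages k \<theta> dt F (s + dt) (\<lambda>j. F j s U) Z \<and>
          V = Z k)"
| "adi_step Hundsdorfer_Verwer k \<theta> dt F s U V \<longleftrightarrow>
     (\<exists>Y Z. Y 0 = U + dt *\<^sub>R total k F s U \<and>
          stages k \<theta> dt F (s + dt) (\<lambda>j. F j s U) Y \<and>
          Z 0 = Y 0 + (1 / 2 * dt) *\<^sub>R (total k F (s + dt) (Y k) - total k F s U) \<and>
          stages k \<theta> dt F (s + dt) (\<lambda>j. F j (s + dt) (Y k)) Z \<and>
          V = Z k)"

definition stab_p :: "nat \<Rightarrow> real \<Rightarrow> (nat \<Rightarrow> real) \<Rightarrow> real" where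
  "stab_p k \<theta> z = (\<Prod>j=1..k. 1 - \<theta> * z j)"

definition stab_fun :: "adi_scheme \<Rightarrow> nat \<Rightarrow> real \<Rightarrow> (nat \<Rightarrow> real) \<Rightarrow> real" where
  "stab_fun S k \<theta> z =
     (let z0 = z 0; zs = (\<Sum>j=1..k. z j); p = stab_p k \<theta> z in
      case S of
        Douglas \<Rightarrow> 1 + (z0 + zs) / p
      | Craig_Sneyd \<Rightarrow> 1 + (z0 + zs) / p + 1 / 2 * (z0 * (z0 + zs) / p\<^sup>2)
      | Modified_Craig_Sneyd \<Rightarrow>
          1 + (z0 + zs) / p + \<theta> * (z0 * (z0 + zs) / p\<^sup>2)
            + (1 / 2 - \<theta>) * ((z0 + zs)\<^sup>2 / p\<^sup>2)
      | Hundsdorfer_Verwer \<Rightarrow>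
          1 + 2 * ((z0 + zs) / p) - (z0 + zs) / p\<^sup>2 + 1 / 2 * ((z0 + zs)\<^sup>2 / p\<^sup>2))"

lemma stages_test_eq:
  fixes Y :: "nat \<Rightarrow> real"
  assumes p: "stab_p k \<theta> (\<lambda>j. dt * lam j) \<noteq> 0"
    and st: "stages k \<theta> dt (\<lambda>j t x. lam j * x) t (\<lambda>j. lam j * W) Y"
  shows "Y k = W + (Y 0 - W) / stab_p k \<theta> (\<lambda>j. dt * lam j)"
proof -
  have "n \<le> k \<Longrightarrow> (Y n - W) * stab_p n \<theta> (\<lambda>j. dt * lam j) = Y 0 - W" for n
  proof (induction n)
    case 0
    then show ?case by (simp add: stab_p_def)
  next
    case (Suc n)
    have "Y (Suc n) = Y n + \<theta> * dt * (lam (Suc n) * Y (Suc n) - lam (Suc n) * W)"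
      using st Suc.prems unfolding stages_def by force
    then have "(Y (Suc n) - W) * (1 - \<theta> * (dt * lam (Suc n))) = Y n - W"
      by (simp add: algebra_simps)
    moreover have "(Y n - W) * stab_p n \<theta> (\<lambda>j. dt * lam j) = Y 0 - W"
      using Suc by simp
    moreover have "stab_p (Suc n) \<theta> (\<lambda>j. dt * lam j) =
        (1 - \<theta> * (dt * lam (Suc n))) * stab_p n \<theta> (\<lambda>j. dt * lam j)"
      by (simp add: stab_p_def mult.commute)
    ultimately show ?case
      by (metis mult.assoc)
  qed
  from this[of k] p show ?thesis by (simp add: field_simps)
qed

lemma stages_test_ex:
  fixes Y0 W :: real
  assumes p: "stab_p k \<theta> (\<lambda>j. dt * lam j) \<noteq> 0"
  obtains Y where "Y 0 = Y0"
    and "stages k \<theta> dt (\<lambda>j t x. lam j * x) t (\<lambda>j. lam j * W) Y"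
proof -
  define Y where "Y n = W + (Y0 - W) / stab_p n \<theta> (\<lambda>j. dt * lam j)" for n
  have "Y j = Y (j - 1) + \<theta> * dt * (lam j * Y j - lam j * W)" if "j \<in> {1..k}" for j
  proof -
    obtain n where n: "j = Suc n" using \<open>j \<in> {1..k}\<close> not0_implies_Suc[of j] by auto
    have "1 - \<theta> * (dt * lam j) \<noteq> 0"
      using p that unfolding stab_p_def by (metis finite_atLeastAtMost prod_zero_iff)
    moreover have "stab_p n \<theta> (\<lambda>j. dt * lam j) \<noteq> 0"
      using p that n unfolding stab_p_def by (auto simp: prod_zero_iff)
    ultimately show ?thesis
      unfolding Y_def n stab_p_def by (simp add: field_simps)
  qed
  then show ?thesis using that[of Y] by (auto simp: stages_def Y_def stab_p_def)
qed

text \<open>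
  \<^const>\<open>stab_fun\<close> is the stability function: on the scalar test equation the scheme
  has exactly one solution, \<open>U\<^sub>n = M(z\<^sub>0,\<dots>,z\<^sub>k) U\<^sub>n\<^sub>-\<^sub>1\<close>.
\<close>

lemma adi_step_test_equation:
  fixes U V :: real
  assumes p: "stab_p k \<theta> (\<lambda>j. dt * lam j) \<noteq> 0"
  shows "adi_step S k \<theta> dt (\<lambda>j t x. lam j * x) s U V \<longleftrightarrow>
         V = stab_fun S k \<theta> (\<lambda>j. dt * lam j) * U"
proof -
  define P where "P = stab_p k \<theta> (\<lambda>j. dt * lam j)"
  define z0 where "z0 = dt * lam 0"
  define w where "w = z0 + (\<Sum>j=1..k. dt * lam j)"
  note P0 = p[folded P_def]
  let ?F = "\<lambda>(j::nat) (t::real) x. lam j * x"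
  have tot: "dt * total k ?F t x = w * x" for t x
    by (simp add: total_def w_def z0_def sum.atLeast_Suc_atMost sum_distrib_left sum_distrib_right
        algebra_simps)
  have tot2: "c * dt * (total k ?F t x - total k ?F t' y) = c * w * (x - y)" for c t x t' y
    using tot[of t x] tot[of t' y] by (simp add: algebra_simps)
  have z02: "c * dt * (lam 0 * x - lam 0 * y) = c * z0 * (x - y)" for c x y
    by (simp add: z0_def algebra_simps)
  note eq = stages_test_eq[OF p, folded P_def]
  have E: "V = X k \<longleftrightarrow> V = W + (X 0 - W) / P"
    if "stages k \<theta> dt ?F t (\<lambda>j. lam j * W) X" for X W t
    using eq[OF that] by simp
  have ex: "\<exists>X. X 0 = x \<and> stages k \<theta> dt ?F t (\<lambda>j. lam j * W) X" for x t W
    using stages_test_ex[OF p] by metis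
  have Q: "(\<exists>X. X 0 = x \<and> stages k \<theta> dt ?F t (\<lambda>j. lam j * W) X \<and> Q (X k)) \<longleftrightarrow>
        Q (W + (x - W) / P)" for x t W and Q :: "real \<Rightarrow> bool"
    using ex[of x t W] eq by metis
  show ?thesis
  proof (cases S)
    case Douglas
    have "adi_step S k \<theta> dt ?F s U V \<longleftrightarrow> V = U + w * U / P"
      unfolding Douglas adi_step.simps real_scaleR_def tot Q[where Q = "\<lambda>y. V = y"] by simp
    then show ?thesis
      by (simp add: Douglas stab_fun_def Let_def P_def w_def z0_def algebra_simps)
  next
    case Craig_Sneyd
    have "adi_step S k \<theta> dt ?F s U V \<longleftrightarrow>
       (\<exists>Y. Y 0 = U + w * U \<and> stages k \<theta> dt ?F (s + dt) (\<lambda>j. lam j * U) Y \<and>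
         (\<exists>Z. Z 0 = U + w * U + 1/2 * z0 * (Y k - U) \<and>
            stages k \<theta> dt ?F (s + dt) (\<lambda>j. lam j * U) Z \<and> V = Z k))"
      unfolding Craig_Sneyd adi_step.simps real_scaleR_def tot z02
      by (intro iffI; elim exE conjE; fastforce)
    also have "\<dots> \<longleftrightarrow> V = U + (w * U + 1/2 * z0 * (w * U / P)) / P"
      unfolding Q[where Q = "\<lambda>y. V = y"] 
      unfolding Q[where Q = "\<lambda>y. V = U + (U + w * U + 1/2 * z0 * (y - U) - U) / P"]
      by (simp add: algebra_simps)
    also have "U + (w * U + 1/2 * z0 * (w * U / P)) / P
        = stab_fun S k \<theta> (\<lambda>j. dt * lam j) * U"
      unfolding Craig_Sneyd stab_fun_def Let_def P_def[symmetric] z0_def[symmetric]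
        w_def[symmetric] adi_scheme.case
      using P0 by (simp add: field_simps power2_eq_square)
    finally show ?thesis .
  next
    case Modified_Craig_Sneyd
    have "adi_step S k \<theta> dt ?F s U V \<longleftrightarrow>
       (\<exists>Y. Y 0 = U + w * U \<and> stages k \<theta> dt ?F (s + dt) (\<lambda>j. lam j * U) Y \<and>
         (\<exists>Z. Z 0 = U + w * U + \<theta> * z0 * (Y k - U) + (1/2 - \<theta>) * w * (Y k - U) \<and>
            stages k \<theta> dt ?F (s + dt) (\<lambda>j. lam j * U) Z \<and> V = Z k))"
      unfolding Modified_Craig_Sneyd adi_step.simps real_scaleR_def tot tot2 z02
      by (intro iffI; elim exE conjE; fastforce)
    also have "\<dots> \<longleftrightarrow>
        V = U + (w * U + \<theta> * z0 * (w * U / P) + (1/2 - \<theta>) * w * (w * U / P)) / P"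
      unfolding Q[where Q = "\<lambda>y. V = y"]
      unfolding Q[where Q = "\<lambda>y. V = U + (U + w * U + \<theta> * z0 * (y - U)
          + (1/2 - \<theta>) * w * (y - U) - U) / P"]
      by (simp add: algebra_simps)
    also have "U + (w * U + \<theta> * z0 * (w * U / P) + (1/2 - \<theta>) * w * (w * U / P)) / P
        = stab_fun S k \<theta> (\<lambda>j. dt * lam j) * U"
      unfolding Modified_Craig_Sneyd stab_fun_def Let_def P_def[symmetric] z0_def[symmetric]
        w_def[symmetric] adi_scheme.case
      using P0 by (simp add: field_simps power2_eq_square)
    finally show ?thesis .
  next
    case Hundsdorfer_Verwer
    have "adi_step S k \<theta> dt ?F s U V \<longleftrightarrow>
       (\<exists>Y. Y 0 = U + w * U \<and> stages k \<theta> dt ?F (s + dt) (\<lambda>j. lam j * U) Y \<and>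
         (\<exists>Z. Z 0 = U + w * U + 1/2 * w * (Y k - U) \<and>
            stages k \<theta> dt ?F (s + dt) (\<lambda>j. lam j * Y k) Z \<and> V = Z k))"
      unfolding Hundsdorfer_Verwer adi_step.simps real_scaleR_def tot tot2 z02
      by (intro iffI; elim exE conjE; fastforce)
    also have "\<dots> \<longleftrightarrow> V = U + w * U / P + (w * U + 1/2 * w * (w * U / P) - w * U / P) / P"
      unfolding Q[where Q = "\<lambda>y. V = y"]
      unfolding Q[where Q = "\<lambda>y. V = y + (U + w * U + 1/2 * w * (y - U) - y) / P"]
      by (simp add: algebra_simps)
    also have "U + w * U / P + (w * U + 1/2 * w * (w * U / P) - w * U / P) / P
        = stab_fun S k \<theta> (\<lambda>j. dt * lam j) * U"
      unfolding Hundsdorfer_Verwer stab_fun_def Let_def P_def[symmetric] z0_def[symmetric]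
        w_def[symmetric] adi_scheme.case
      using P0 by (simp add: field_simps power2_eq_square)
    finally show ?thesis .
  qed
qed


subsection \<open>The discretization and its scaled eigenvalues\<close>

definition unit_idx :: "nat \<Rightarrow> nat \<Rightarrow> int" where
  "unit_idx i = (\<lambda>n. if n = i then 1 else 0)"

definition second_diff ::
  "(nat \<Rightarrow> real) \<Rightarrow> nat \<Rightarrow> ((nat \<Rightarrow> int) \<Rightarrow> complex) \<Rightarrow> (nat \<Rightarrow> int) \<Rightarrow> complex" where
  "second_diff dx i u l =
     (let e = unit_idx i in
      (u (\<lambda>n. l n + e n) - 2 * u l + u (\<lambda>n. l n - e n)) / of_real ((dx i)\<^sup>2))"

definition mixed_diff ::
  "(nat \<Rightarrow> nat \<Rightarrow> real) \<Rightarrow> (nat \<Rightarrow> real) \<Rightarrow> nat \<Rightarrow> nat \<Rightarrow>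
    ((nat \<Rightarrow> int) \<Rightarrow> complex) \<Rightarrow> (nat \<Rightarrow> int) \<Rightarrow> complex" where
  "mixed_diff \<beta> dx i j u l =
     (let e = unit_idx i; f = unit_idx j in
      (of_real (1 + \<beta> i j) * (u (\<lambda>n. l n + e n + f n) + u (\<lambda>n. l n - e n - f n))
       - of_real (1 - \<beta> i j) * (u (\<lambda>n. l n - e n + f n) + u (\<lambda>n. l n + e n - f n))
       + of_real (\<beta> i j) * (4 * u l - 2 * (u (\<lambda>n. l n + e n) + u (\<lambda>n. l n + f n)
                                       + u (\<lambda>n. l n - e n) + u (\<lambda>n. l n - f n))))
      / of_real (4 * dx i * dx j))"

text \<open>The splitting: index 0 carries all mixed derivatives, index \<open>j \<ge> 1\<close> the term \<open>d\<^sub>j\<^sub>j u\<^sub>j\<^sub>j\<close>.\<close>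

definition split_op ::
  "nat \<Rightarrow> (nat \<Rightarrow> nat \<Rightarrow> real) \<Rightarrow> (nat \<Rightarrow> nat \<Rightarrow> real) \<Rightarrow> (nat \<Rightarrow> real) \<Rightarrow> nat \<Rightarrow>
    ((nat \<Rightarrow> int) \<Rightarrow> complex) \<Rightarrow> (nat \<Rightarrow> int) \<Rightarrow> complex" where
  "split_op k \<beta> d dx j u l =
     (if j = 0 then \<Sum>i=1..k. \<Sum>j\<in>{1..k} - {i}. of_real (d i j) * mixed_diff \<beta> dx i j u l
      else of_real (d j j) * second_diff dx j u l)"

definition fourier_mode :: "nat \<Rightarrow> (nat \<Rightarrow> real) \<Rightarrow> (nat \<Rightarrow> int) \<Rightarrow> complex" where
  "fourier_mode k \<phi> l = cis (\<Sum>j=1..k. of_int (l j) * \<phi> j)"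

definition mesh_ratio :: "real \<Rightarrow> (nat \<Rightarrow> real) \<Rightarrow> nat \<Rightarrow> nat \<Rightarrow> real" where
  "mesh_ratio dt dx i j = dt / (dx i * dx j)"

definition scaled_eigval ::
  "nat \<Rightarrow> (nat \<Rightarrow> nat \<Rightarrow> real) \<Rightarrow> (nat \<Rightarrow> nat \<Rightarrow> real) \<Rightarrow> real \<Rightarrow> (nat \<Rightarrow> real) \<Rightarrow>
    (nat \<Rightarrow> real) \<Rightarrow> nat \<Rightarrow> real" where
  "scaled_eigval k \<beta> d dt dx \<phi> j =
     (if j = 0 then
        \<Sum>i=1..k. \<Sum>j\<in>{1..k} - {i}. mesh_ratio dt dx i j * d i j *
          (- sin (\<phi> i) * sin (\<phi> j) + \<beta> i j * (1 - cos (\<phi> i)) * (1 - cos (\<phi> j)))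
      else - 2 * mesh_ratio dt dx j j * d j j * (1 - cos (\<phi> j)))"

lemma fourier_mode_add:
  "fourier_mode k \<phi> (\<lambda>n. l n + l' n) = fourier_mode k \<phi> l * fourier_mode k \<phi> l'"
  by (simp add: fourier_mode_def cis_mult sum.distrib algebra_simps)

lemma fourier_mode_unit:
  assumes "i \<in> {1..k}"
  shows "fourier_mode k \<phi> (unit_idx i) = cis (\<phi> i)"
    and "fourier_mode k \<phi> (\<lambda>n. - unit_idx i n) = cis (- \<phi> i)"
proof -
  have "(\<Sum>j=1..k. of_int (unit_idx i j) * \<phi> j) = (\<Sum>j=1..k. if j = i then \<phi> j else 0)"
    by (intro sum.cong) (auto simp: unit_idx_def)
  also have "\<dots> = \<phi> i" using assms by simp
  finally have *: "(\<Sum>j=1..k. of_int (unit_idx i j) * \<phi> j) = \<phi> i" .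
  show "fourier_mode k \<phi> (unit_idx i) = cis (\<phi> i)"
    unfolding fourier_mode_def * ..
  show "fourier_mode k \<phi> (\<lambda>n. - unit_idx i n) = cis (- \<phi> i)"
    using arg_cong[OF *, of uminus] unfolding sum_negf[symmetric] by (simp add: fourier_mode_def)
qed

lemma second_diff_fourier:
  assumes "i \<in> {1..k}"
  shows "second_diff dx i (fourier_mode k \<phi>) l =
         of_real (- 2 * (1 - cos (\<phi> i)) / (dx i)\<^sup>2) * fourier_mode k \<phi> l"
proof -
  have "cis (\<phi> i) - 2 + cis (- \<phi> i) = of_real (- 2 * (1 - cos (\<phi> i)))"
    by (simp add: complex_eq_iff)
  moreover have "second_diff dx i (fourier_mode k \<phi>) l =
      fourier_mode k \<phi> l * (cis (\<phi> i) - 2 + cis (- \<phi> i)) / of_real ((dx i)\<^sup>2)"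
    unfolding second_diff_def Let_def diff_conv_add_uminus fourier_mode_add
      fourier_mode_unit[OF assms]
    by (simp add: algebra_simps)
  ultimately show ?thesis by simp
qed

lemma mixed_diff_fourier:
  assumes "i \<in> {1..k}" "j \<in> {1..k}"
  shows "mixed_diff \<beta> dx i j (fourier_mode k \<phi>) l =
         of_real ((- sin (\<phi> i) * sin (\<phi> j) + \<beta> i j * (1 - cos (\<phi> i)) * (1 - cos (\<phi> j)))
                  / (dx i * dx j)) * fourier_mode k \<phi> l"
proof -
  define a b where "a = cis (\<phi> i)" and "b = cis (\<phi> j)"
  define a' b' where "a' = cis (- \<phi> i)" and "b' = cis (- \<phi> j)"
  note ab = a_def b_def a'_def b'_def
  have e: "of_real (1 + \<beta> i j) * (a * b + a' * b') - of_real (1 - \<beta> i j) * (a' * b + a * b')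
      + of_real (\<beta> i j) * (4 - 2 * (a + b + a' + b'))
    = of_real (4 * (- sin (\<phi> i) * sin (\<phi> j) + \<beta> i j * (1 - cos (\<phi> i)) * (1 - cos (\<phi> j))))"
    by (simp add: complex_eq_iff ab algebra_simps)
  have "mixed_diff \<beta> dx i j (fourier_mode k \<phi>) l = fourier_mode k \<phi> l *
      (of_real (1 + \<beta> i j) * (a * b + a' * b') - of_real (1 - \<beta> i j) * (a' * b + a * b')
      + of_real (\<beta> i j) * (4 - 2 * (a + b + a' + b'))) / of_real (4 * dx i * dx j)"
    unfolding mixed_diff_def Let_def diff_conv_add_uminus[of "l _"]
      diff_conv_add_uminus[of "l _ + _"] fourier_mode_add
      diff_conv_add_uminus[of "l _ + _ _"] fourier_mode_unit[OF assms(1)]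
      fourier_mode_unit[OF assms(2)] ab[symmetric]
    by (simp add: algebra_simps)
  also have "\<dots> = of_real ((- sin (\<phi> i) * sin (\<phi> j)
      + \<beta> i j * (1 - cos (\<phi> i)) * (1 - cos (\<phi> j))) / (dx i * dx j)) * fourier_mode k \<phi> l"
    proof -
    have "F * of_real (4 * c) / of_real (4 * dx i * dx j) = of_real (c / (dx i * dx j)) * F"
      for F :: complex and c
      by simp
    then show ?thesis unfolding e .
  qed
  finally show ?thesis .
qed

lemma fourier_mode_periodic_iff:
  assumes "j \<in> {1..k}" "m \<ge> 1"
  shows "(\<forall>l. fourier_mode k \<phi> (\<lambda>n. l n + int m * unit_idx j n) = fourier_mode k \<phi> l) \<longleftrightarrow>
         (\<exists>q :: int. \<phi> j = of_int q * (2 * pi / of_nat m))"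
proof -
  have "(\<Sum>i=1..k. of_int (int m * unit_idx j i) * \<phi> i) =
      (\<Sum>i=1..k. if i = j then real m * \<phi> i else 0)"
    by (intro sum.cong) (auto simp: unit_idx_def)
  also have "\<dots> = real m * \<phi> j" using assms(1) by simp
  finally have *: "fourier_mode k \<phi> (\<lambda>n. int m * unit_idx j n) = cis (real m * \<phi> j)"
    unfolding fourier_mode_def by simp
  have nz: "fourier_mode k \<phi> l \<noteq> 0" for l
    by (simp add: fourier_mode_def)
  have "(\<forall>l. fourier_mode k \<phi> (\<lambda>n. l n + int m * unit_idx j n) = fourier_mode k \<phi> l) \<longleftrightarrow>
      cis (real m * \<phi> j) = 1"
    unfolding fourier_mode_add * using nz by auto
  also have "\<dots> \<longleftrightarrow> cos (real m * \<phi> j) = 1"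
    by (auto simp: complex_eq_iff cos_one_sin_zero)
  also have "\<dots> \<longleftrightarrow> (\<exists>q :: int. \<phi> j = of_int q * (2 * pi / of_nat m))"
    unfolding cos_one_2pi_int using assms(2) by (simp add: field_simps)
  finally show ?thesis .
qed

text \<open>
  The Fourier modes diagonalize all \<open>A\<^sub>j\<close> simultaneously, with \<^const>\<open>scaled_eigval\<close> as
  the eigenvalues of \<open>\<Delta>t A\<^sub>j\<close>.
\<close>

lemma split_op_fourier:
  assumes "j \<le> k"
  shows "of_real dt * split_op k \<beta> d dx j (fourier_mode k \<phi>) l =
         of_real (scaled_eigval k \<beta> d dt dx \<phi> j) * fourier_mode k \<phi> l"
proof (cases "j = 0")
  case True
  have "of_real dt * split_op k \<beta> d dx j (fourier_mode k \<phi>) l =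
     (\<Sum>i=1..k. \<Sum>j\<in>{1..k} - {i}.
        of_real (mesh_ratio dt dx i j * d i j *
          (- sin (\<phi> i) * sin (\<phi> j) + \<beta> i j * (1 - cos (\<phi> i)) * (1 - cos (\<phi> j))))
        * fourier_mode k \<phi> l)"
    unfolding split_op_def True if_P[OF refl] sum_distrib_left
    by (intro sum.cong refl) (auto simp: mixed_diff_fourier mesh_ratio_def simp del: of_real_minus)
  also have "\<dots> = of_real (scaled_eigval k \<beta> d dt dx \<phi> j) * fourier_mode k \<phi> l"
    unfolding scaled_eigval_def True if_P[OF refl] of_real_sum sum_distrib_right by (rule refl)
  finally show ?thesis .
next
  case False
  with assms have "j \<in> {1..k}" by simp
  have "dt * (d j j * (- 2 * (1 - cos (\<phi> j)) / (dx j)\<^sup>2)) =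
      - 2 * (dt / (dx j * dx j)) * d j j * (1 - cos (\<phi> j))"
    by (simp only: power2_eq_square divide_inverse mult_ac mult_1_left)
  then show ?thesis
    unfolding split_op_def scaled_eigval_def second_diff_fourier[OF \<open>j \<in> {1..k}\<close>] mesh_ratio_def
      if_not_P[OF False] mult.assoc[symmetric] of_real_mult[symmetric]
    by (simp only: mult.assoc)
qed


subsection \<open>Unconditional stability\<close>

definition unconditionally_stable ::
  "adi_scheme \<Rightarrow> real \<Rightarrow> nat \<Rightarrow> (nat \<Rightarrow> nat \<Rightarrow> real) \<Rightarrow> (nat \<Rightarrow> nat \<Rightarrow> real) \<Rightarrow> bool" where
  "unconditionally_stable S \<theta> k \<beta> d \<longleftrightarrow>
     (\<forall>dt dx. \<forall>m :: nat \<Rightarrow> nat. \<forall>\<phi>.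
        dt > 0 \<longrightarrow> (\<forall>i\<in>{1..k}. dx i > 0) \<longrightarrow> (\<forall>j\<in>{1..k}. m j \<ge> 1) \<longrightarrow>
        (\<forall>j\<in>{1..k}. \<exists>q :: int. \<phi> j = of_int q * (2 * pi / of_nat (m j))) \<longrightarrow>
        \<bar>stab_fun S k \<theta> (scaled_eigval k \<beta> d dt dx \<phi>)\<bar> \<le> 1)"


subsection \<open>The constants in the bounds\<close>

definition coef_d :: "nat \<Rightarrow> real" where
  "coef_d k = (1 - 1 / of_nat k) ^ (k - 1)"

definition coef_c :: "nat \<Rightarrow> real" where
  "coef_c k = (1 - 1 / of_nat k) ^ k"

definition coef_b :: "nat \<Rightarrow> real" where
  "coef_b k = 1 / (1 + (1 + 1 / (of_nat k - 1)) ^ (k - 1))"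

definition coef_a :: "nat \<Rightarrow> real" where
  "coef_a k = (THE a. a \<in> {0<..<1 / 2} \<and>
                 2 * a * (1 + (1 - a) / (of_nat k - 1)) ^ (k - 1) - 1 = 0)"

lemma coef_a_ex1:
  assumes "k \<ge> 2"
  shows "\<exists>!a :: real. a \<in> {0<..<1 / 2} \<and>
           2 * a * (1 + (1 - a) / (of_nat k - 1)) ^ (k - 1) - 1 = 0"
proof -
  obtain n where n: "k = Suc (Suc n)" using assms
    by (metis add_2_eq_Suc le_Suc_ex)
  define N where "N = real (Suc n)"
  have N: "N > 0" by (simp add: N_def)
  define f where "f a = 2 * a * (1 + (1 - a) / N) ^ Suc n - 1" for a :: real
  have cont: "continuous_on {0..1/2} f"
    unfolding f_def using N by (intro continuous_intros) auto
  have der: "(f has_real_derivative 2 * (1 + (1 - a) / N) ^ n * (1 + (1 - a) / N - a)) (at a)" for a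
  proof -
    have "(f has_real_derivative 2 * (1 + (1 - a) / N) ^ Suc n +
        2 * a * (real (Suc n) * (1 + (1 - a) / N) ^ n * (- 1 / N))) (at a)"
    proof -
      have "((\<lambda>a. 1 + (1 - a) / N) has_real_derivative - 1 / N) (at a)"
        using N by (auto intro!: derivative_eq_intros simp: field_simps)
      from DERIV_power[OF this, of "Suc n"]
      have pw: "((\<lambda>a. (1 + (1 - a) / N) ^ Suc n) has_real_derivative
          real (Suc n) * (1 + (1 - a) / N) ^ n * (- 1 / N)) (at a)"
        by (simp only: diff_Suc_1 One_nat_def[symmetric] mult_ac)
      have "((\<lambda>a. 2 * a) has_real_derivative 2) (at a)"
        by (auto intro!: derivative_eq_intros)
      from DERIV_diff[OF DERIV_mult[OF this pw] DERIV_const[of 1]]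
      show ?thesis unfolding f_def by (simp only: diff_0_right mult_ac)
    qed
    moreover have "real (Suc n) * (1 + (1 - a) / N) ^ n * (- 1 / N) = - ((1 + (1 - a) / N) ^ n)"
      using N by (simp add: N_def)
    moreover have "2 * q ^ Suc n + 2 * a * (- (q ^ n)) = 2 * q ^ n * (q - a)" for q :: real
      by (simp add: algebra_simps)
    ultimately show ?thesis by metis
  qed
  have mono: "f a < f b" if "0 < a" "a < b" "b < 1/2" for a b
  proof (rule DERIV_pos_imp_increasing[OF that(2)])
    fix x assume x: "a \<le> x" "x \<le> b"
    then have "(1 - x) / N > 0" using that N by simp
    then have "2 * (1 + (1 - x) / N) ^ n * (1 + (1 - x) / N - x) > 0"
      using x that by (intro mult_pos_pos zero_less_power) auto
    then show "\<exists>y. (f has_real_derivative y) (at x) \<and> 0 < y" using der by blast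
  qed
  have f0: "f 0 < 0" by (simp add: f_def)
  have "1 < (1 + (1 - 1/2) / N) ^ Suc n" using N by (intro one_less_power) auto
  then have f1: "f (1/2) > 0" by (simp add: f_def)
  obtain a where "0 \<le> a" "a \<le> 1/2" "f a = 0"
    using IVT'[of f 0 0 "1/2"] f0 f1 cont by auto
  moreover have "a \<noteq> 0" "a \<noteq> 1/2" using f0 f1 \<open>f a = 0\<close> by (metis less_irrefl)+
  ultimately have a: "a \<in> {0<..<1/2} \<and> f a = 0" by auto
  have "b = a" if "b \<in> {0<..<1/2} \<and> f b = 0" for b
    using mono[of a b] mono[of b a] a that by (cases a b rule: linorder_cases) auto
  with a have "\<exists>!a. a \<in> {0<..<1/2} \<and> f a = 0" by blast
  moreover have "f a = 2 * a * (1 + (1 - a) / (of_nat k - 1)) ^ (k - 1) - 1" for a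
    by (simp add: f_def n N_def)
  ultimately show ?thesis by simp
qed

end

theory Submission
  imports Defs
begin

text \<open>
  Two families of equations already force the bounds.

  Pure diffusion in a single direction gives \<open>z\<^sub>0 = 0\<close> and one nonzero \<open>z\<^sub>j = -y\<close>, where
  \<open>y > 0\<close> is arbitrary. Letting \<open>y \<rightarrow> \<infinity>\<close> gives the constants \<open>1/2\<close> and \<open>1/4\<close>.

  The bounds that involve \<open>\<gamma>\<close> come from the equicorrelated matrix with \<open>d\<^sub>i\<^sub>i = 1\<close> and
  \<open>d\<^sub>i\<^sub>j = \<gamma>\<close>. Take unit mesh widths and the same small angle \<open>\<phi>\<close> in every direction, and
  choose the time step \<open>y / \<phi>\<^sup>2\<close>. As \<open>\<phi> \<rightarrow> 0\<close>, the diffusion terms tend to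
  \<open>z\<^sub>j = -y\<close> and the sine part of the mixed term to \<open>z\<^sub>0 = -\<gamma> k (k - 1) y\<close>, whereas the part
  weighted by \<open>\<beta>\<^sub>i\<^sub>j\<close> is of order \<open>\<phi>\<^sup>4 / \<phi>\<^sup>2\<close> and disappears. By continuity of the stability function, \<open>\<bar>M\<bar> \<le> 1\<close> persists at
  these limit points (lemma \<open>stab_fun_equicorrelated\<close>).

  At every such point \<open>\<bar>M\<bar> \<le> 1\<close> implies a polynomial inequality
  in \<open>p = (1 + \<theta> y)\<^sup>k\<close>, for Douglas \<open>-(z\<^sub>0 + z) \<le> 2 p\<close>, and similarly for the
  other schemes. With \<open>x = \<theta> y\<close> it is a lower bound on \<open>\<theta>\<close> for each \<open>x > 0\<close>. The strongest
  one is obtained at \<open>x = 1 / (k - 1)\<close> for the first three schemes, and at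
  \<open>x = (1 - a\<^sub>k) / (k - 1)\<close> for Hundsdorfer--Verwer: in the variable \<open>a = 1 - (k - 1) x\<close>, the
  critical point equation of \<open>x / (4 (1 + x)\<^sup>k - 2)\<close> is the defining equation of \<open>a\<^sub>k\<close>.
\<close>

section \<open>Necessary inequalities for \<open>\<bar>M\<bar> \<le> 1\<close>\<close>

text \<open>
  Each inequality is one of the two sides of \<open>\<bar>M\<bar> \<le> 1\<close>: for Douglas it is \<open>M \<ge> -1\<close>; for the
  other schemes it is \<open>M \<le> 1\<close>, after division of \<open>M - 1\<close> by the negative number \<open>(z\<^sub>0 + z) / p\<close>.
\<close>

lemma stab_fun_le_1_imp:
  fixes z :: "nat \<Rightarrow> real" and k :: nat and \<theta> :: real
  defines "w \<equiv> z 0 + (\<Sum>j=1..k. z j)" and "p \<equiv> stab_p k \<theta> z"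
  assumes p: "p > 0" and w: "w < 0" and M: "\<bar>stab_fun S k \<theta> z\<bar> \<le> 1"
  shows "case S of
      Douglas \<Rightarrow> - w \<le> 2 * p
    | Craig_Sneyd \<Rightarrow> - z 0 \<le> 2 * p
    | Modified_Craig_Sneyd \<Rightarrow> - w \<le> 2 * p - 2 * \<theta> * (w - z 0)
    | Hundsdorfer_Verwer \<Rightarrow> - w \<le> 4 * p - 2"
proof -
  have sgn: "0 \<le> e" if "w / p * e \<le> 0" for e
    using that p w by (simp add: zero_le_mult_iff mult_le_0_iff divide_le_0_iff zero_le_divide_iff)
  note def = stab_fun_def Let_def w_def[symmetric] p_def[symmetric]
  show ?thesis
  proof (cases S)
    case Douglas
    have "- 1 \<le> 1 + w / p"
      using M unfolding Douglas def by (simp add: abs_le_iff)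
    then show ?thesis
      using p by (simp add: Douglas field_simps)
  next
    case Craig_Sneyd
    have "w / p * (1 + z 0 / (2 * p)) \<le> 0"
      using M unfolding Craig_Sneyd def
      by (simp add: abs_le_iff algebra_simps power2_eq_square)
    from sgn[OF this] show ?thesis
      using p by (simp add: Craig_Sneyd field_simps)
  next
    case Modified_Craig_Sneyd
    have "w / p * (1 + \<theta> * z 0 / p + (1 / 2 - \<theta>) * w / p) = stab_fun S k \<theta> z - 1"
      using p unfolding Modified_Craig_Sneyd def by (simp add: field_simps power2_eq_square)
    with M have "w / p * (1 + \<theta> * z 0 / p + (1 / 2 - \<theta>) * w / p) \<le> 0"
      by (simp add: abs_le_iff)
    from mult_nonneg_nonneg[OF less_imp_le[OF p] sgn[OF this]]
    have "0 \<le> p + \<theta> * z 0 + (1 / 2 - \<theta>) * w"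
      using p by (simp add: distrib_left)
    then show ?thesis
      by (simp add: Modified_Craig_Sneyd algebra_simps)
  next
    case Hundsdorfer_Verwer
    have "w / p * (2 - 1 / p + w / (2 * p)) \<le> 0"
      using M unfolding Hundsdorfer_Verwer def
      by (simp add: abs_le_iff algebra_simps power2_eq_square)
    from sgn[OF this] show ?thesis
      using p by (simp add: Hundsdorfer_Verwer field_simps)
  qed
qed

text \<open>
  For Craig--Sneyd the side \<open>M \<le> 1\<close> is void when \<open>z\<^sub>0 = 0\<close>; this identity supplies the other
  side, which is the Douglas inequality.
\<close>

lemma stab_fun_Craig_Sneyd_eq_Douglas:
  assumes "z 0 = 0"
  shows "stab_fun Craig_Sneyd k \<theta> z = stab_fun Douglas k \<theta> z"
  using assms by (simp add: stab_fun_def)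

lemma tendsto_stab_fun:
  assumes "\<And>j. j \<le> k \<Longrightarrow> (\<lambda>n. Z n j) \<longlonglongrightarrow> z j" and "stab_p k \<theta> z \<noteq> 0"
  shows "(\<lambda>n. stab_fun S k \<theta> (Z n)) \<longlonglongrightarrow> stab_fun S k \<theta> z"
proof -
  have "(\<lambda>n. Z n 0) \<longlonglongrightarrow> z 0"
    using assms(1) by simp
  moreover have "(\<lambda>n. \<Sum>j=1..k. Z n j) \<longlonglongrightarrow> (\<Sum>j=1..k. z j)"
    using assms(1) by (intro tendsto_sum) auto
  moreover have "(\<lambda>n. stab_p k \<theta> (Z n)) \<longlonglongrightarrow> stab_p k \<theta> z"
    unfolding stab_p_def using assms(1) by (intro tendsto_prod tendsto_intros) auto
  ultimately show ?thesis
    unfolding stab_fun_def Let_def using assms(2)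
    by (cases S) (auto intro!: tendsto_intros)
qed

section \<open>The two test families\<close>

lemma pos_semidef_single_direction:
  "pos_semidef k (\<lambda>i j. if i = 1 \<and> j = 1 then 1 else 0)"
proof -
  have "(\<Sum>i=1..k. \<Sum>j=1..k. x i * (if i = 1 \<and> j = 1 then 1 else 0) * x j) \<ge> 0"
    for x :: "nat \<Rightarrow> real"
    by (intro sum_nonneg) auto
  then show ?thesis
    unfolding pos_semidef_def by (simp add: conj_commute)
qed

lemma pos_semidef_equicorrelated:
  assumes "0 \<le> \<gamma>" "\<gamma> \<le> 1"
  shows "pos_semidef k (\<lambda>i j. if i = j then 1 else \<gamma>)"
proof -
  have "(\<Sum>i=1..k. \<Sum>j=1..k. x i * (if i = j then 1 else \<gamma>) * x j) \<ge> 0" for x :: "nat \<Rightarrow> real"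
  proof -
    have "(\<Sum>i=1..k. \<Sum>j=1..k. x i * (if i = j then 1 else \<gamma>) * x j) =
        (\<Sum>i=1..k. \<Sum>j=1..k. \<gamma> * (x i * x j) + (if i = j then (1 - \<gamma>) * (x i)\<^sup>2 else 0))"
      by (intro sum.cong refl) (auto simp: algebra_simps power2_eq_square)
    also have "\<dots> = \<gamma> * (\<Sum>i=1..k. x i)\<^sup>2 + (1 - \<gamma>) * (\<Sum>i=1..k. (x i)\<^sup>2)"
      by (simp add: sum.distrib power2_eq_square[of "sum x _"] sum_product
          sum_distrib_left[symmetric])
    also have "\<dots> \<ge> 0"
      using assms by (intro add_nonneg_nonneg mult_nonneg_nonneg sum_nonneg) auto
    finally show ?thesis .
  qed
  then show ?thesis
    unfolding pos_semidef_def by auto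
qed

text \<open>
  A grid with two points suffices in one direction: the angle \<open>\<pi>\<close> in direction 1 and zero
  elsewhere give \<open>z\<^sub>1 = -4 \<Delta>t\<close>, so every negative value is attained exactly.
\<close>

lemma stab_fun_single_direction:
  assumes stable: "unconditionally_stable S \<theta> k \<beta> (\<lambda>i j. if i = 1 \<and> j = 1 then 1 else 0)"
    and y: "y > 0"
  shows "\<bar>stab_fun S k \<theta> (\<lambda>j. if j = 1 then - y else 0)\<bar> \<le> 1"
proof -
  let ?d = "\<lambda>i j :: nat. if i = 1 \<and> j = 1 then 1 else 0 :: real"
  let ?\<phi> = "\<lambda>j :: nat. if j = 1 then pi else 0"
  have "\<forall>j\<in>{1..k}. \<exists>q :: int. ?\<phi> j = of_int q * (2 * pi / of_nat 2)"
  proof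
    fix j
    show "\<exists>q :: int. ?\<phi> j = of_int q * (2 * pi / of_nat 2)"
      by (rule exI[of _ "if j = 1 then 1 else 0"]) auto
  qed
  then have "\<bar>stab_fun S k \<theta> (scaled_eigval k \<beta> ?d (y / 4) (\<lambda>_. 1) ?\<phi>)\<bar> \<le> 1"
    using stable[unfolded unconditionally_stable_def, rule_format,
        of "y / 4" "\<lambda>_. 1" "\<lambda>_. 2" ?\<phi>] y by auto
  moreover have "scaled_eigval k \<beta> ?d (y / 4) (\<lambda>_. 1) ?\<phi> = (\<lambda>j. if j = 1 then - y else 0)"
    by (rule ext) (auto simp: scaled_eigval_def mesh_ratio_def intro!: sum.neutral split: if_splits)
  ultimately show ?thesis
    by simp
qed

lemma tendsto_sin_over_id: "((\<lambda>x :: real. sin x / x) \<longlongrightarrow> 1) (at 0)"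
  using DERIV_sin[of "0 :: real"] by (simp add: has_field_derivative_iff)

lemma tendsto_one_minus_cos_over_square:
  "((\<lambda>x :: real. (1 - cos x) / x\<^sup>2) \<longlongrightarrow> 1 / 2) (at 0)"
proof -
  have half: "((\<lambda>x :: real. x / 2) \<longlongrightarrow> 0) (at 0)"
    by (auto intro!: tendsto_eq_intros)
  have "((\<lambda>x :: real. sin (x / 2) / (x / 2)) \<longlongrightarrow> 1) (at 0)"
    by (rule filterlim_compose[OF tendsto_sin_over_id])
      (auto simp: filterlim_at eventually_at_filter intro: half)
  then have "((\<lambda>x :: real. 1 / 2 * (sin (x / 2) / (x / 2))\<^sup>2) \<longlongrightarrow> 1 / 2 * 1\<^sup>2) (at 0)"
    by (intro tendsto_intros)
  moreover have "1 / 2 * (sin (x / 2) / (x / 2))\<^sup>2 = (1 - cos x) / x\<^sup>2" for x :: real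
    using cos_double_sin[of "x / 2"] by (simp add: power_divide)
  ultimately show ?thesis
    by (simp only: power_one mult_1_right)
qed

text \<open>
  The long-wave limit: with \<open>\<Delta>t = y / \<phi>\<^sup>2\<close> the mixed-derivative eigenvalue stays of the same
  order as the others, so that all implicit directions and the explicit mixed term act at once.
\<close>

lemma stab_fun_equicorrelated:
  assumes stable: "unconditionally_stable S \<theta> k \<beta> (\<lambda>i j. if i = j then 1 else \<gamma>)"
    and y: "y > 0" and \<theta>: "\<theta> > 0" and k: "k \<ge> 1"
  shows "\<bar>stab_fun S k \<theta> (\<lambda>j. if j = 0 then - \<gamma> * real k * (real k - 1) * y else - y)\<bar> \<le> 1"
proof -
  let ?d = "\<lambda>i j :: nat. if i = j then 1 else \<gamma>"
  let ?z = "\<lambda>j :: nat. if j = 0 then - \<gamma> * real k * (real k - 1) * y else - y"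
  define f where "f n = 2 * pi / real (Suc n)" for n
  define Z where "Z n = scaled_eigval k \<beta> ?d (y / (f n)\<^sup>2) (\<lambda>_. 1) (\<lambda>_. f n)" for n
  have f_pos: "f n > 0" for n
    by (simp add: f_def)
  have f_0: "f \<longlonglongrightarrow> 0"
    unfolding f_def by (intro LIMSEQ_Suc lim_const_over_n)
  then have f: "filterlim f (at 0) sequentially"
    using f_pos by (simp add: filterlim_at less_imp_neq[symmetric])
  have sin_lim: "(\<lambda>n. sin (f n) / f n) \<longlonglongrightarrow> 1"
    by (rule filterlim_compose[OF tendsto_sin_over_id f])
  have cos_lim: "(\<lambda>n. (1 - cos (f n)) / (f n)\<^sup>2) \<longlonglongrightarrow> 1 / 2"
    by (rule filterlim_compose[OF tendsto_one_minus_cos_over_square f])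
  have Z_le: "\<bar>stab_fun S k \<theta> (Z n)\<bar> \<le> 1" for n
  proof -
    have "\<forall>j\<in>{1..k}. \<exists>q :: int. f n = of_int q * (2 * pi / of_nat (Suc n))"
      unfolding f_def by (intro ballI exI[of _ 1]) simp
    then show ?thesis
      unfolding Z_def
      using stable[unfolded unconditionally_stable_def, rule_format,
          of "y / (f n)\<^sup>2" "\<lambda>_. 1" "\<lambda>_. Suc n" "\<lambda>_. f n"] y f_pos[of n] by auto
  qed
  have Z_lim: "(\<lambda>n. Z n j) \<longlonglongrightarrow> ?z j" for j
  proof (cases "j = 0")
    case True
    define b where "b = (\<Sum>i=1..k. \<Sum>j\<in>{1..k} - {i}. \<beta> i j)"
    have card: "(\<Sum>i=1..k. \<Sum>j\<in>{1..k} - {i}. c) = real k * (real k - 1) * c" for c :: real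
      using k by (simp add: of_nat_diff)
    have "Z n 0 = \<gamma> * y * (- real k * (real k - 1) * (sin (f n) / f n)\<^sup>2
        + b * (((1 - cos (f n)) / (f n)\<^sup>2)\<^sup>2 * (f n)\<^sup>2))" for n
    proof -
      define s where "s = \<gamma> * y * (sin (f n) / f n)\<^sup>2"
      define c where "c = \<gamma> * y * (((1 - cos (f n)) / (f n)\<^sup>2)\<^sup>2 * (f n)\<^sup>2)"
      have "Z n 0 = (\<Sum>i=1..k. \<Sum>j\<in>{1..k} - {i}. - s + \<beta> i j * c)"
        unfolding Z_def scaled_eigval_def mesh_ratio_def s_def c_def if_P[OF refl]
        using f_pos[of n]
        by (intro sum.cong refl) (auto simp: field_simps power2_eq_square)
      also have "\<dots> = real k * (real k - 1) * (- s) + b * c"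
        unfolding sum.distrib card b_def sum_distrib_right ..
      finally show ?thesis
        by (simp add: s_def c_def algebra_simps)
    qed
    moreover have "(\<lambda>n. \<gamma> * y * (- real k * (real k - 1) * (sin (f n) / f n)\<^sup>2
        + b * (((1 - cos (f n)) / (f n)\<^sup>2)\<^sup>2 * (f n)\<^sup>2)))
        \<longlonglongrightarrow> \<gamma> * y * (- real k * (real k - 1) * 1\<^sup>2 + b * ((1 / 2)\<^sup>2 * 0\<^sup>2))"
      by (intro tendsto_intros sin_lim cos_lim f_0)
    ultimately have "(\<lambda>n. Z n 0)
        \<longlonglongrightarrow> \<gamma> * y * (- real k * (real k - 1) * 1\<^sup>2 + b * ((1 / 2)\<^sup>2 * 0\<^sup>2))"
      by (simp only:)
    then show ?thesis
      by (simp add: True mult_ac)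
  next
    case False
    have "(\<lambda>n. - 2 * y * ((1 - cos (f n)) / (f n)\<^sup>2)) \<longlonglongrightarrow> - 2 * y * (1 / 2)"
      by (intro tendsto_intros cos_lim)
    then show ?thesis
      using False by (simp add: Z_def scaled_eigval_def mesh_ratio_def)
  qed
  have "stab_p k \<theta> ?z > 0"
    unfolding stab_p_def
  proof (intro prod_pos ballI)
    fix j assume "j \<in> {1..k}"
    moreover have "0 < \<theta> * y"
      using \<theta> y by simp
    ultimately show "0 < 1 - \<theta> * ?z j"
      by auto
  qed
  then have "(\<lambda>n. \<bar>stab_fun S k \<theta> (Z n)\<bar>) \<longlonglongrightarrow> \<bar>stab_fun S k \<theta> ?z\<bar>"
    by (intro tendsto_rabs tendsto_stab_fun Z_lim) auto
  then show ?thesis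
    by (rule LIMSEQ_le_const2) (use Z_le in auto)
qed

section \<open>The lower bounds on \<open>\<theta>\<close>\<close>

lemma slope_ge_1_if_dominates:
  fixes b c :: real
  assumes "\<And>y. y > 0 \<Longrightarrow> y \<le> c + b * y"
  shows "b \<ge> 1"
proof (rule ccontr)
  assume "\<not> b \<ge> 1"
  moreover define y where "y = (\<bar>c\<bar> + 1) / (1 - b)"
  ultimately have "y > 0" "(1 - b) * y = \<bar>c\<bar> + 1"
    by auto
  with assms[of y] show False
    by (simp add: algebra_simps)
qed

lemma theta_bound_single_direction:
  assumes k: "k \<ge> 1" and \<theta>: "\<theta> > 0"
    and M: "\<And>y. y > 0 \<Longrightarrow> \<bar>stab_fun S k \<theta> (\<lambda>j. if j = 1 then - y else 0)\<bar> \<le> 1"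
  shows "\<theta> \<ge> (if S = Douglas \<or> S = Craig_Sneyd then 1 / 2 else 1 / 4)"
proof -
  let ?z = "\<lambda>y j. if j = 1 then - y else 0 :: real"
  have p: "stab_p k \<theta> (?z y) = 1 + \<theta> * y" for y
  proof -
    have "stab_p k \<theta> (?z y) = (\<Prod>j=1..k. if j = 1 then 1 + \<theta> * y else 1)"
      unfolding stab_p_def by (intro prod.cong) auto
    then show ?thesis
      using k by simp
  qed
  have w: "(\<Sum>j=1..k. ?z y j) = - y" for y
    using k by simp
  have pos: "1 + \<theta> * y > 0" if "y > 0" for y
    using that \<theta> by (simp add: add_pos_pos)
  have bound: "case T of Douglas \<Rightarrow> y \<le> 2 * (1 + \<theta> * y)
      | Craig_Sneyd \<Rightarrow> True
      | Modified_Craig_Sneyd \<Rightarrow> y \<le> 2 * (1 + \<theta> * y) + 2 * \<theta> * y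
      | Hundsdorfer_Verwer \<Rightarrow> y \<le> 4 * (1 + \<theta> * y) - 2"
    if "\<bar>stab_fun T k \<theta> (?z y)\<bar> \<le> 1" "y > 0" for T y
    using stab_fun_le_1_imp[of k \<theta> "?z y" T, unfolded p w] that pos[of y]
    by (cases T) auto
  show ?thesis
  proof (cases S)
    case Douglas
    then have "2 * \<theta> \<ge> 1"
      using bound[OF M] by (intro slope_ge_1_if_dominates[where c = 2]) (simp add: algebra_simps)
    with Douglas show ?thesis by simp
  next
    case Craig_Sneyd
    then have "\<bar>stab_fun Douglas k \<theta> (?z y)\<bar> \<le> 1" if "y > 0" for y
      using M[OF that] stab_fun_Craig_Sneyd_eq_Douglas[of "?z y"] by simp
    then have "2 * \<theta> \<ge> 1"
      using bound[of Douglas]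
      by (intro slope_ge_1_if_dominates[where c = 2]) (simp add: algebra_simps)
    with Craig_Sneyd show ?thesis by simp
  next
    case Modified_Craig_Sneyd
    then have "4 * \<theta> \<ge> 1"
      using bound[OF M] by (intro slope_ge_1_if_dominates[where c = 2]) (simp add: algebra_simps)
    with Modified_Craig_Sneyd show ?thesis by simp
  next
    case Hundsdorfer_Verwer
    then have "4 * \<theta> \<ge> 1"
      using bound[OF M] by (intro slope_ge_1_if_dominates[where c = 2]) (simp add: algebra_simps)
    with Hundsdorfer_Verwer show ?thesis by simp
  qed
qed

lemma equicorrelated_inequality:
  fixes x \<gamma> \<theta> :: real and k :: nat
  assumes k: "k \<ge> 1" and \<theta>: "\<theta> > 0" and \<gamma>: "\<gamma> \<ge> 0" and x: "x > 0"
    and M: "\<And>y. y > 0 \<Longrightarrow>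
      \<bar>stab_fun S k \<theta> (\<lambda>j. if j = 0 then - \<gamma> * real k * (real k - 1) * y else - y)\<bar> \<le> 1"
  defines "\<kappa> \<equiv> (real k - 1) * \<gamma> + 1"
  shows "case S of
      Douglas \<Rightarrow> real k * x * \<kappa> \<le> \<theta> * (2 * (1 + x) ^ k)
    | Craig_Sneyd \<Rightarrow> real k * (real k - 1) * x * \<gamma> \<le> \<theta> * (2 * (1 + x) ^ k)
    | Modified_Craig_Sneyd \<Rightarrow> real k * x * \<kappa> \<le> \<theta> * (2 * (1 + x) ^ k + 2 * real k * x)
    | Hundsdorfer_Verwer \<Rightarrow> real k * x * \<kappa> \<le> \<theta> * (4 * (1 + x) ^ k - 2)"
proof -
  define y where "y = x / \<theta>"
  have y: "y > 0" and xy: "x = \<theta> * y"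
    using \<theta> x by (simp_all add: y_def)
  let ?z = "\<lambda>j :: nat. if j = 0 then - \<gamma> * real k * (real k - 1) * y else - y"
  have p: "stab_p k \<theta> ?z = (1 + x) ^ k"
  proof -
    have "stab_p k \<theta> ?z = (\<Prod>j=1..k. 1 + x)"
      unfolding stab_p_def xy by (intro prod.cong) auto
    then show ?thesis by simp
  qed
  have s: "(\<Sum>j=1..k. ?z j) = - (real k * y)"
    by simp
  have w: "?z 0 + (\<Sum>j=1..k. ?z j) = - (real k * y * \<kappa>)"
    unfolding s by (simp add: \<kappa>_def algebra_simps)
  have "\<kappa> > 0"
    unfolding \<kappa>_def using k \<gamma> by (intro add_nonneg_pos mult_nonneg_nonneg) auto
  then have neg: "- (real k * y * \<kappa>) < 0"
    using k y by simp
  have z0: "- (real k * y * \<kappa>) - ?z 0 = - (real k * y)"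
    by (simp add: \<kappa>_def algebra_simps)
  note ineq = stab_fun_le_1_imp[of k \<theta> ?z S, unfolded p w z0, OF _ neg M[OF y]]
  have scale: "\<theta> * y * a \<le> \<theta> * b" if "y * a \<le> b" for a b
    using mult_left_mono[OF that, of \<theta>] \<theta> by (simp add: mult.assoc)
  show ?thesis
  proof (cases S)
    case Douglas
    with ineq x have "y * (real k * \<kappa>) \<le> 2 * (1 + x) ^ k"
      by (simp add: mult_ac)
    from scale[OF this] show ?thesis
      unfolding Douglas xy[symmetric] by (simp add: mult_ac)
  next
    case Craig_Sneyd
    with ineq x have "y * (real k * (real k - 1) * \<gamma>) \<le> 2 * (1 + x) ^ k"
      by (simp add: mult_ac)
    from scale[OF this] show ?thesis
      unfolding Craig_Sneyd xy[symmetric] by (simp add: mult_ac)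
  next
    case Modified_Craig_Sneyd
    with ineq x have "y * (real k * \<kappa>) \<le> 2 * (1 + x) ^ k + 2 * real k * x"
      unfolding xy by (simp add: mult_ac)
    from scale[OF this] show ?thesis
      unfolding Modified_Craig_Sneyd xy[symmetric] by (simp add: mult_ac)
  next
    case Hundsdorfer_Verwer
    with ineq x have "y * (real k * \<kappa>) \<le> 4 * (1 + x) ^ k - 2"
      by (simp add: mult_ac)
    from scale[OF this] show ?thesis
      unfolding Hundsdorfer_Verwer xy[symmetric] by (simp add: mult_ac)
  qed
qed

text \<open>
  For the first three schemes \<open>x\<close> minimizes \<open>(1 + x)\<^sup>k / x\<close>; the relation \<open>1 + x = k x\<close> at the
  minimum cancels one factor and leaves the power \<open>k - 1\<close> in \<open>d\<^sub>k\<close> and \<open>b\<^sub>k\<close>.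
\<close>

lemma theta_bound_equicorrelated:
  fixes k :: nat and \<gamma> \<theta> :: real
  assumes k: "k \<ge> 2" and \<theta>: "\<theta> > 0" and \<gamma>: "\<gamma> \<ge> 0"
    and M: "\<And>y. y > 0 \<Longrightarrow>
      \<bar>stab_fun S k \<theta> (\<lambda>j. if j = 0 then - \<gamma> * real k * (real k - 1) * y else - y)\<bar> \<le> 1"
  defines "\<kappa> \<equiv> (real k - 1) * \<gamma> + 1"
  shows "\<theta> \<ge> (case S of
      Douglas \<Rightarrow> 1 / 2 * coef_d k * \<kappa>
    | Craig_Sneyd \<Rightarrow> 1 / 2 * coef_c k * real k * \<gamma>
    | Modified_Craig_Sneyd \<Rightarrow> 1 / 2 * coef_b k * \<kappa>
    | Hundsdorfer_Verwer \<Rightarrow> 1 / 2 * coef_a k * \<kappa>)"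
proof -
  define n where "n = k - 1"
  have kn: "k = Suc n" "real k = real n + 1" "n > 0"
    using k by (simp_all add: n_def of_nat_diff)
  have ineq: "x > 0 \<Longrightarrow> case S of
      Douglas \<Rightarrow> real k * x * \<kappa> \<le> \<theta> * (2 * (1 + x) ^ k)
    | Craig_Sneyd \<Rightarrow> real k * (real k - 1) * x * \<gamma> \<le> \<theta> * (2 * (1 + x) ^ k)
    | Modified_Craig_Sneyd \<Rightarrow> real k * x * \<kappa> \<le> \<theta> * (2 * (1 + x) ^ k + 2 * real k * x)
    | Hundsdorfer_Verwer \<Rightarrow> real k * x * \<kappa> \<le> \<theta> * (4 * (1 + x) ^ k - 2)" for x
    unfolding \<kappa>_def using equicorrelated_inequality[OF _ \<theta> \<gamma> _ M, of x] k by simp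
  have cancel: "\<kappa> \<le> \<theta> * b" if "real k * x * \<kappa> \<le> \<theta> * (real k * x * b)" "x > 0" for x b
  proof -
    have "real k * x * \<kappa> \<le> real k * x * (\<theta> * b)"
      using that(1) by (simp add: mult_ac)
    moreover have "real k * x > 0"
      using k that(2) by simp
    ultimately show ?thesis
      by (simp only: mult_le_cancel_left_pos)
  qed
  define x where "x = 1 / real n"
  have x: "x > 0" and kx: "1 + x = real k * x" and nx: "real n * x = 1"
    using kn by (simp_all add: x_def field_simps)
  have inv: "1 - 1 / real k = 1 / (1 + x)"
    using kn by (simp add: x_def field_simps)
  have pow: "(1 + x) ^ k = real k * x * (1 + x) ^ n"
    unfolding kn(1) power_Suc kx[unfolded kn(1)] ..
  have pos: "(1 + x) ^ m > 0" for m
    using x by simp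
  show ?thesis
  proof (cases S)
    case Douglas
    have "\<kappa> \<le> \<theta> * (2 * (1 + x) ^ n)"
      by (rule cancel[OF _ x]) (use ineq[OF x] Douglas pow in \<open>simp add: mult_ac\<close>)
    moreover have "coef_d k = 1 / (1 + x) ^ n"
      unfolding coef_d_def inv n_def[symmetric] by (simp add: power_one_over)
    ultimately show ?thesis
      using Douglas pos[of n] by (simp add: field_simps)
  next
    case Craig_Sneyd
    have "real k * (real k - 1) * x * \<gamma> = real k * \<gamma>"
      using nx kn(2) by simp
    with ineq[OF x] Craig_Sneyd have "real k * \<gamma> \<le> \<theta> * (2 * (1 + x) ^ k)"
      by simp
    moreover have "coef_c k = 1 / (1 + x) ^ k"
      unfolding coef_c_def inv by (simp add: power_one_over)
    ultimately show ?thesis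
      using Craig_Sneyd pos[of k] by (simp add: field_simps)
  next
    case Modified_Craig_Sneyd
    have "\<kappa> \<le> \<theta> * (2 * (1 + x) ^ n + 2)"
      by (rule cancel[OF _ x])
        (use ineq[OF x] Modified_Craig_Sneyd pow in \<open>simp add: algebra_simps\<close>)
    moreover have "coef_b k = 1 / (1 + (1 + x) ^ n)"
      unfolding coef_b_def n_def[symmetric] x_def kn(2) by simp
    moreover have "0 < 1 + (1 + x) ^ n"
      using pos[of n] by simp
    ultimately show ?thesis
      using pos_divide_le_eq[of "2 * (1 + (1 + x) ^ n)" \<kappa> \<theta>] Modified_Craig_Sneyd
      by (simp add: distrib_left add.commute)
  next
    case Hundsdorfer_Verwer
    define a where "a = coef_a k"
    have "a \<in> {0<..<1 / 2} \<and> 2 * a * (1 + (1 - a) / (real k - 1)) ^ (k - 1) - 1 = 0"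
      unfolding a_def coef_a_def by (rule theI'[OF coef_a_ex1[OF k]])
    then have a: "0 < a" "a < 1 / 2" and eq: "2 * a * (1 + (1 - a) / real n) ^ n = 1"
      by (auto simp: kn)
    \<comment> \<open>the maximizer of \<open>x / (4 (1 + x)\<^sup>k - 2)\<close>, chosen so that \<open>1 + v - a = k v\<close>\<close>
    define v where "v = (1 - a) / real n"
    have v: "v > 0" and nv: "real n * v = 1 - a"
      using a kn by (simp_all add: v_def)
    have "(1 + v) ^ n = 1 / (2 * a)"
      using eq a by (simp add: v_def field_simps)
    then have "4 * (1 + v) ^ k - 2 = 4 * ((1 + v) * (1 / (2 * a))) - 2"
      by (simp only: kn(1) power_Suc)
    also have "\<dots> = 2 * (1 + v - a) / a"
      using a by (simp add: field_simps)
    also have "1 + v - a = real k * v"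
      using nv by (simp add: kn(2) algebra_simps)
    finally have "4 * (1 + v) ^ k - 2 = real k * v * (2 / a)"
      by simp
    with ineq[OF v] Hundsdorfer_Verwer have "\<kappa> \<le> \<theta> * (2 / a)"
      by (intro cancel[OF _ v]) simp
    then show ?thesis
      using Hundsdorfer_Verwer a by (simp add: a_def[symmetric] field_simps)
  qed
qed

theorem theorem4:
  fixes k :: nat and \<gamma> \<theta> :: real and \<beta> :: "nat \<Rightarrow> nat \<Rightarrow> real" and S :: adi_scheme
  assumes "k \<ge> 2"
    and "0 \<le> \<gamma>" and "\<gamma> \<le> 1"
    and "\<And>i j. i \<in> {1..k} \<Longrightarrow> j \<in> {1..k} \<Longrightarrow> i \<noteq> j \<Longrightarrow> \<beta> i j = \<beta> j i"
    and "\<And>i. i \<in> {1..k} \<Longrightarrow> \<beta> i i = -1"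
    and "pos_semidef k (\<lambda>i j. - \<beta> i j)"
    and "\<theta> > 0"
    and "\<And>d. pos_semidef k d \<Longrightarrow>
           (\<And>i j. i \<in> {1..k} \<Longrightarrow> j \<in> {1..k} \<Longrightarrow> i \<noteq> j \<Longrightarrow>
              \<bar>d i j\<bar> \<le> \<gamma> * sqrt (d i i * d j j)) \<Longrightarrow>
           unconditionally_stable S \<theta> k \<beta> d"
  shows "case S of
      Douglas \<Rightarrow> \<theta> \<ge> max (1 / 2) (1 / 2 * coef_d k * ((of_nat k - 1) * \<gamma> + 1))
    | Craig_Sneyd \<Rightarrow> \<theta> \<ge> max (1 / 2) (1 / 2 * coef_c k * of_nat k * \<gamma>)
    | Modified_Craig_Sneyd \<Rightarrow> \<theta> \<ge> max (1 / 4) (1 / 2 * coef_b k * ((of_nat k - 1) * \<gamma> + 1))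
    | Hundsdorfer_Verwer \<Rightarrow> \<theta> \<ge> max (1 / 4) (1 / 2 * coef_a k * ((of_nat k - 1) * \<gamma> + 1))"
proof -
  have "unconditionally_stable S \<theta> k \<beta> (\<lambda>i j. if i = 1 \<and> j = 1 then 1 else 0)"
    using assms(2) by (intro assms(8) pos_semidef_single_direction) auto
  from stab_fun_single_direction[OF this] theta_bound_single_direction[of k \<theta> S]
  have single: "\<theta> \<ge> (if S = Douglas \<or> S = Craig_Sneyd then 1 / 2 else 1 / 4)"
    using assms(1,7) by simp
  have "unconditionally_stable S \<theta> k \<beta> (\<lambda>i j. if i = j then 1 else \<gamma>)"
    using assms(2,3) by (intro assms(8) pos_semidef_equicorrelated) auto
  from theta_bound_equicorrelated[OF assms(1,7,2) stab_fun_equicorrelated[OF this]]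
  show ?thesis
    using single assms(1,7) by (cases S) simp_all
qed

end
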